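(* For all $n \geq 0$, $$p_{\xi}(3n+1) \equiv \begin{cases} 2 \pmod{4}, & \text{if } 3n+1 \text{ is a square},\\ 0 \pmod{4}, & \text{otherwise}.\end{cases}$$
   Context: $(a;q)_n=(1-a)(1-aq)\cdots(1-aq^{n-1})$, $(a;q)_0=1$. The coefficients $p_\xi(n)$ are defined by $\sum_{n\ge0}p_\xi(n)q^n=\xi(q)=1+2\sum_{n\ge1}\frac{q^{6n^2-6n+1}}{(q;q^6)_n(q^5;q^6)_n}$. *)

theory Defs
  imports
    "HOL-Computational_Algebra.Formal_Power_Series"
    "HOL-Number_Theory.Cong"
begin

definition qpoch :: "'a::comm_ring_1 \<Rightarrow> 'a \<Rightarrow> nat \<Rightarrow> 'a" where
  "qpoch a q n = (\<Prod>k<n. 1 - a * q ^ k)"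

definition xi_denom :: "nat \<Rightarrow> int fps" where
  "xi_denom n = qpoch fps_X (fps_X ^ 6) n * qpoch (fps_X ^ 5) (fps_X ^ 6) n"

text \<open>
  The type \<^typ>\<open>int\<close> has no inverse operation, so \<^term>\<open>inverse\<close> is not available on
  \<^typ>\<open>int fps\<close>. The second argument 1 of \<^term>\<open>fps_right_inverse\<close> is the inverse of the
  constant coefficient of the denominator; lemma \<open>xi_denom_inverse\<close> shows that the result is
  the multiplicative inverse. Only the terms with n at least 1 are used, so the
  subtraction in the exponent never truncates.
\<close>

definition xi_term :: "nat \<Rightarrow> int fps" where
  "xi_term n = fps_X ^ (6 * n ^ 2 - 6 * n + 1) * fps_right_inverse (xi_denom n) 1"

text \<open>
  The infinite sum is taken in the usual (X-adic) topology on formal power series; it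
  converges by lemma \<open>summable_xi_term\<close>.
\<close>

definition xi :: "int fps" where
  "xi = 1 + 2 * (\<Sum>n. xi_term (Suc n))"

definition p_xi :: "nat \<Rightarrow> int" where
  "p_xi n = fps_nth xi n"

lemma qpoch_nth_0:
  fixes a q :: "int fps"
  assumes "fps_nth a 0 = 0"
  shows "fps_nth (qpoch a q n) 0 = 1"
  unfolding qpoch_def by (induction n) (simp_all add: assms)

lemma xi_denom_nth_0: "fps_nth (xi_denom n) 0 = 1"
  by (simp add: xi_denom_def qpoch_nth_0)

lemma xi_denom_inverse: "xi_denom n * fps_right_inverse (xi_denom n) 1 = 1"
  by (rule fps_right_inverse) (simp add: xi_denom_nth_0)

lemma xi_term_nth_eq_0:
  assumes "m \<le> n"
  shows "fps_nth (xi_term (Suc n)) m = 0"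
proof -
  have "m < 6 * (Suc n) ^ 2 - 6 * Suc n + 1"
    using assms by (simp add: power2_eq_square)
  then show ?thesis
    unfolding xi_term_def by (simp only: fps_X_power_mult_nth if_True)
qed

lemma summable_xi_term: "summable (\<lambda>n. xi_term (Suc n))"
proof -
  let ?S = "Abs_fps (\<lambda>m. \<Sum>k<m. fps_nth (xi_term (Suc k)) m)"
  have "(\<lambda>N. \<Sum>k<N. xi_term (Suc k)) \<longlonglongrightarrow> ?S"
  proof (rule tendsto_fpsI)
    fix m
    have "fps_nth (\<Sum>k<N. xi_term (Suc k)) m = fps_nth ?S m" if "N \<ge> m" for N
      unfolding fps_sum_nth fps_nth_Abs_fps
      by (rule sum.mono_neutral_right) (use that in \<open>auto simp: xi_term_nth_eq_0\<close>)
    then show "\<forall>\<^sub>F N in sequentially. fps_nth (\<Sum>k<N. xi_term (Suc k)) m = fps_nth ?S m"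
      using eventually_sequentially by blast
  qed
  then show ?thesis
    by (auto simp: summable_def sums_def)
qed

end

theory Submission
  imports
    Defs
    "HOL-Library.Z2"
    "HOL-Computational_Algebra.Formal_Laurent_Series"
begin

text \<open>
  Write \<open>P\<close>, \<open>R\<close>, \<open>D\<close> for the infinite products \<open>(q^6;q^6)\<close>, \<open>(q^2;q^2)\<close> and
  \<open>(q;q^6)(q^5;q^6)\<close>.  The summands of \<open>\<xi>\<close> involve the Bailey pair given by the partial fraction
  expansion of \<open>1 / ((x;q)_n (q/x;q)_n)\<close>, so Bailey's lemma turns \<open>(\<xi> - 1) / 2q\<close> into \<open>1/P\<close> times
  \<open>\<Sum>r\<ge>0. (-1)^r q^(9r(r+1)) (1 - q^(12r+6)) / ((1 - q^(6r+1)) (1 - q^(6r+5)))\<close>.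
  As \<open>P\<close> is a series in \<open>q^3\<close>, the exponents divisible by 3 can be extracted term by term, by means
  of \<open>1/(1 - q^a) = (1 + q^a + q^(2a)) / (1 - q^(3a))\<close>.  The result, with \<open>q^3\<close> replaced by \<open>q\<close>, is
  the limiting case of the same partial fractions, whence it equals \<open>P^2 / (R D)\<close>.  Modulo 2,
  Euler's identity \<open>(t;t) (t;t^2) = 1\<close> gives \<open>P = R D^2\<close>, so this is \<open>P D\<close>, and by the Jacobi
  triple product \<open>P D = \<Sum>r. q^(3r^2 - 2r)\<close> modulo 2; here \<open>3 (3r^2 - 2r) + 1 = (3r - 1)^2\<close>.
  All limits are handled through exact finite identities and truncation modulo \<open>q^N\<close>.
\<close>

subsection \<open>Finite \<open>q\<close>-series identities over a field\<close>

lemma qpoch_0 [simp]: "qpoch a q 0 = 1"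
  and qpoch_Suc: "qpoch a q (Suc n) = qpoch a q n * (1 - a * q ^ n)"
  by (simp_all add: qpoch_def)

lemma qpoch_nonzero:
  fixes a q :: "'a :: idom"
  assumes "\<And>k. a * q ^ k \<noteq> 1"
  shows "qpoch a q n \<noteq> 0"
  using assms by (auto simp: qpoch_def)

lemma choose_2_Suc: "Suc j choose 2 = j + (j choose 2)"
  by (simp add: numeral_2_eq_2)

context
  fixes q :: "'a :: field"
  assumes q: "\<And>k. q * q ^ k \<noteq> 1"
begin

lemma one_minus_q_power_nonzero: "k > 0 \<Longrightarrow> 1 - q ^ k \<noteq> 0"
  using q[of "k - 1"] by (cases k) auto

lemma qpoch_q_Suc: "qpoch q q (Suc n) = qpoch q q n * (1 - q ^ Suc n)"
  by (simp add: qpoch_Suc)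

text \<open>Partial sums of the unit Bailey pair relative to \<open>q\<close>; the sum telescopes.\<close>

lemma unit_bailey_sum:
  assumes "j < m"
  shows "(\<Sum>r\<le>j. (-1) ^ r * q ^ (r choose 2) * (1 - q ^ (2 * r + 1)) /
           (qpoch q q (m - r) * qpoch q q (m + 1 + r))) =
         (-1) ^ j * q ^ (Suc j choose 2) * (1 - q ^ Suc j) /
           ((1 - q ^ m) * qpoch q q (m - Suc j) * qpoch q q (m + 1 + j))"
  using assms
proof (induction j)
  case 0
  then obtain k where m: "m = Suc k"
    using gr0_implies_Suc by blast
  have [simp]: "qpoch q q n \<noteq> 0" for n
    by (rule qpoch_nonzero[OF q])
  have [simp]: "1 - q * q ^ k \<noteq> 0"
    using q[of k] by simp
  show ?case
    by (simp add: m qpoch_q_Suc numeral_2_eq_2 field_simps)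
next
  case (Suc j)
  then obtain k where m: "m = Suc (Suc (j + k))"
    using less_natE by (metis add_Suc)
  define A B Q K where "A = qpoch q q k" and "B = qpoch q q (m + 1 + j)"
    and "Q = q ^ j" and "K = q ^ k"
  have A: "A \<noteq> 0" and B: "B \<noteq> 0"
    unfolding A_def B_def by (rule qpoch_nonzero[OF q])+
  have nz: "1 - q ^ m \<noteq> 0" "1 - q ^ Suc k \<noteq> 0" "1 - q ^ (m + j + 2) \<noteq> 0"
    by (rule one_minus_q_power_nonzero; simp add: m)+
  have eqs: "qpoch q q (m - Suc j) = A * (1 - q ^ Suc k)" "qpoch q q (m - Suc (Suc j)) = A"
      "qpoch q q (m + 1 + Suc j) = B * (1 - q ^ (m + j + 2))"
    by (simp_all add: m A_def B_def qpoch_q_Suc)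
  have pw: "q ^ m = q\<^sup>2 * Q * K" "q ^ (m + j + 2) = q ^ 4 * Q\<^sup>2 * K" "q ^ Suc k = q * K"
      "q ^ (2 * Suc j + 1) = q ^ 3 * Q\<^sup>2" "q ^ Suc (Suc j) = q\<^sup>2 * Q"  "q ^ Suc j = q * Q"
    by (simp_all add: m Q_def K_def power_add power_mult power2_eq_square eval_nat_numeral)
  have c2: "q ^ (Suc (Suc j) choose 2) = q * Q * q ^ (Suc j choose 2)"
    by (simp add: choose_2_Suc power_add Q_def)
  \<comment> \<open>The two fractions are combined for abstract entries, so that no power of
    \<open>q\<close> gets expanded.\<close>
  have alg: "a / (u * (A * v) * B) - b / (A * v * (B * z)) = - c / (u * A * (B * z))"
    if "a * z - b * u = - c * v" "u \<noteq> 0" "v \<noteq> 0" "z \<noteq> 0" for a b c u v z :: 'a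
  proof -
    have "a / (u * (A * v) * B) - b / (A * v * (B * z)) = (a * z - b * u) / (u * A * v * B * z)"
      using that A B by (simp add: divide_simps)
    also have "\<dots> = - c / (u * A * (B * z))"
      unfolding that(1) using that A B by (simp add: divide_simps)
    finally show ?thesis .
  qed
  have "(\<Sum>r\<le>Suc j. (-1) ^ r * q ^ (r choose 2) * (1 - q ^ (2 * r + 1)) /
           (qpoch q q (m - r) * qpoch q q (m + 1 + r))) =
      (-1) ^ j * q ^ (Suc j choose 2) * ((1 - q ^ Suc j) / ((1 - q ^ m) * (A * (1 - q ^ Suc k)) * B)
      - (1 - q ^ (2 * Suc j + 1)) / (A * (1 - q ^ Suc k) * (B * (1 - q ^ (m + j + 2)))))"
  proof -
    have "(\<Sum>r\<le>j. (-1) ^ r * q ^ (r choose 2) * (1 - q ^ (2 * r + 1)) /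
           (qpoch q q (m - r) * qpoch q q (m + 1 + r))) = (-1) ^ j * q ^ (Suc j choose 2) *
           ((1 - q ^ Suc j) / ((1 - q ^ m) * (A * (1 - q ^ Suc k)) * B))"
      unfolding eqs(1)[symmetric] B_def using Suc by simp
    moreover have "(-1) ^ Suc j * q ^ (Suc j choose 2) * (1 - q ^ (2 * Suc j + 1)) /
           (qpoch q q (m - Suc j) * qpoch q q (m + 1 + Suc j)) = - ((-1) ^ j * q ^ (Suc j choose 2) *
           ((1 - q ^ (2 * Suc j + 1)) / (A * (1 - q ^ Suc k) * (B * (1 - q ^ (m + j + 2))))))"
      unfolding eqs by simp
    ultimately show ?thesis
      unfolding sum.atMost_Suc right_diff_distrib by simp
  qed
  also have "\<dots> = (-1) ^ j * q ^ (Suc j choose 2) * (- (q * Q * (1 - q ^ Suc (Suc j))) /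
      ((1 - q ^ m) * A * (B * (1 - q ^ (m + j + 2)))))"
    proof -
    \<comment> \<open>With \<open>Q = q^j\<close> and \<open>K = q^k\<close>, telescoping comes down
      to this polynomial identity in three variables.\<close>
    have "(1 - q * Q) * (1 - q ^ 4 * Q\<^sup>2 * K) - (1 - q ^ 3 * Q\<^sup>2) * (1 - q\<^sup>2 * Q * K) =
        - (q * Q * (1 - q\<^sup>2 * Q)) * (1 - q * K)"
      by algebra
    then show ?thesis
      by (subst alg[where c = "q * Q * (1 - q ^ Suc (Suc j))", OF _ nz]) (simp_all only: pw)
  qed
  also have "\<dots> = (-1) ^ Suc j * q ^ (Suc (Suc j) choose 2) * (1 - q ^ Suc (Suc j)) /
           ((1 - q ^ m) * qpoch q q (m - Suc (Suc j)) * qpoch q q (m + 1 + Suc j))"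
    unfolding eqs c2 by simp
  finally show ?case .
qed

text \<open>Induction on \<open>n\<close>, with \<open>m = n + 1\<close>: dividing the identity for
  \<open>n\<close> by \<open>w m\<close> splits each summand into the summand for \<open>m\<close>
  and a multiple of \<open>1 / w m\<close>. By \<open>unit_bailey_sum\<close> the latter add up to
  the one new summand.\<close>

lemma inverse_qpoch_partial_fractions:
  fixes x y :: 'a
  assumes xy: "x * y = q" and x: "\<And>k. x * q ^ k \<noteq> 1" and y: "\<And>k. y * q ^ k \<noteq> 1"
  shows "1 / (qpoch x q (Suc n) * qpoch y q (Suc n)) =
         (\<Sum>r\<le>n. (-1) ^ r * q ^ (Suc r choose 2) * (1 - q ^ (2 * r + 1)) /
           ((1 - x * q ^ r) * (1 - y * q ^ r) * qpoch q q (n - r) * qpoch q q (n + 1 + r)))"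
proof (induction n)
  case 0
  have "1 - q \<noteq> 0"
    using q[of 0] by simp
  then show ?case
    by (simp add: qpoch_Suc numeral_2_eq_2)
next
  case (Suc n)
  define w where "w = (\<lambda>r. (1 - x * q ^ r) * (1 - y * q ^ r))"
  define m where "m = Suc n"
  have w: "w r \<noteq> 0" for r
    using x[of r] y[of r] by (simp add: w_def)
  have P: "qpoch q q k \<noteq> 0" for k
    by (rule qpoch_nonzero[OF q])
  \<comment> \<open>Since \<open>x y = q\<close>, the terms in \<open>x + y\<close> cancel and the
    difference is free of \<open>x\<close> and \<open>y\<close>.\<close>
  have w_diff: "w m - q ^ (m - r) * w r = (1 - q ^ (m - r)) * (1 - q ^ (m + 1 + r))"
    if "r \<le> n" for r
  proof -
    have "r \<le> m"
      using that by (simp add: m_def)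
    then obtain k where k: "m = r + k"
      using le_Suc_ex by blast
    show ?thesis
      unfolding w_def k xy[symmetric] by (simp add: power_add) algebra
  qed
  define c where "c = (\<lambda>r. (-1) ^ r * q ^ (Suc r choose 2) * (1 - q ^ (2 * r + 1)))"
  define d where "d = (\<lambda>r. qpoch q q (m - r) * qpoch q q (m + 1 + r))"
  have step: "c r / (w r * qpoch q q (n - r) * qpoch q q (n + 1 + r)) / w m =
      c r / (w r * d r) - q ^ m / w m * ((-1) ^ r * q ^ (r choose 2) * (1 - q ^ (2 * r + 1)) / d r)"
    if r: "r \<le> n" for r
  proof -
    define a b where "a = qpoch q q (n - r)" and "b = qpoch q q (n + 1 + r)"
    have u: "1 - q ^ (m - r) \<noteq> 0" and v: "1 - q ^ (m + 1 + r) \<noteq> 0"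
      by (rule one_minus_q_power_nonzero; use r in \<open>simp add: m_def\<close>)+
    have ab: "a \<noteq> 0" "b \<noteq> 0"
      unfolding a_def b_def by (rule P)+
    have d: "d r = a * b * ((1 - q ^ (m - r)) * (1 - q ^ (m + 1 + r)))"
      using r by (simp add: d_def a_def b_def m_def Suc_diff_le qpoch_q_Suc)
    have qm: "q ^ m = q ^ (m - r) * q ^ r"
      using r by (simp add: m_def flip: power_add)
    have "c r / (w r * a * b) / w m =
        c r * (w m - q ^ (m - r) * w r) / (w r * w m * d r)"
      unfolding w_diff[OF r] d using w[of r] w[of m] ab u v by (simp add: divide_simps)
    also have "\<dots> = c r / (w r * d r) - q ^ (m - r) * c r / (w m * d r)"
    proof -
      have "d r \<noteq> 0"
        using ab u v by (simp add: d)
      then show ?thesis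
        using w[of r] w[of m] by (simp add: divide_simps) (simp add: algebra_simps)
    qed
    also have "q ^ (m - r) * c r = q ^ m * ((-1) ^ r * q ^ (r choose 2) * (1 - q ^ (2 * r + 1)))"
      by (simp add: c_def qm choose_2_Suc power_add)
    finally show ?thesis
      by (simp add: a_def b_def)
  qed
  have "1 / (qpoch x q (Suc m) * qpoch y q (Suc m)) = 1 / (qpoch x q m * qpoch y q m) / w m"
    by (simp add: qpoch_Suc w_def ac_simps)
  also have "\<dots> = (\<Sum>r\<le>n. c r / (w r * qpoch q q (n - r) * qpoch q q (n + 1 + r)) / w m)"
    unfolding m_def Suc.IH c_def w_def sum_divide_distrib by simp
  also have "\<dots> = (\<Sum>r\<le>n. c r / (w r * d r)) -
      q ^ m / w m * (\<Sum>r\<le>n. (-1) ^ r * q ^ (r choose 2) * (1 - q ^ (2 * r + 1)) / d r)"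
    unfolding sum_distrib_left sum_subtractf[symmetric]
    by (rule sum.cong) (simp_all only: atMost_iff step)
  \<comment> \<open>What is left over \<open>w m\<close> is the unit Bailey sum for
    \<open>m\<close>, stopped one short of \<open>r = m\<close>.\<close>
  also have "(\<Sum>r\<le>n. (-1) ^ r * q ^ (r choose 2) * (1 - q ^ (2 * r + 1)) / d r) =
      (-1) ^ n * q ^ (m choose 2) * (1 - q ^ m) /
           ((1 - q ^ m) * qpoch q q (m - m) * qpoch q q (m + 1 + n))"
    unfolding d_def m_def by (rule unit_bailey_sum) simp
  also have "\<dots> = (-1) ^ n * q ^ (m choose 2) / qpoch q q (2 * m)"
    using one_minus_q_power_nonzero[of m] by (simp add: m_def mult_2)
  \<comment> \<open>The remainder is exactly the missing summand \<open>r = m\<close>.\<close>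
  also have "- (q ^ m / w m * \<dots>) = c m / (w m * d m)"
  proof -
    have "1 - q ^ Suc (2 * m) \<noteq> 0"
      by (rule one_minus_q_power_nonzero) simp
    then have "(1 - q ^ (2 * m + 1)) / d m = 1 / qpoch q q (2 * m)"
      by (simp add: d_def qpoch_q_Suc mult_2 del: power_Suc)
    moreover have "c m / (w m * d m) =
        (-1) ^ m * q ^ (Suc m choose 2) / w m * ((1 - q ^ (2 * m + 1)) / d m)"
      by (simp add: c_def)
    moreover have "(-1) ^ m = - ((-1) ^ n :: 'a)"
      by (simp add: m_def)
    ultimately show ?thesis
      by (simp add: choose_2_Suc[of m] power_add)
  qed
  then have "(\<Sum>r\<le>n. c r / (w r * d r)) - q ^ m / w m * ((-1) ^ n * q ^ (m choose 2) / qpoch q q (2 * m))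
      = (\<Sum>r\<le>m. c r / (w r * d r))"
    unfolding m_def sum.atMost_Suc by simp
  finally show ?case
    unfolding m_def[symmetric] c_def w_def d_def by (simp only: mult.assoc)
qed

section \<open>The q-Vandermonde sum and the q-binomial theorem\<close>

text \<open>Multiplication by \<open>1 - q^(M+1) = (1 - q^(M+1-m)) q^m + (1 - q^m)\<close> splits
  every summand. After an index shift the pieces recombine to the summands for \<open>M\<close> and
  \<open>s + 1\<close>, which is why the induction keeps \<open>s\<close> arbitrary.\<close>

lemma q_vandermonde:
  "(\<Sum>m\<le>M. q ^ (m * (m + s)) / (qpoch q q (M - m) * qpoch q q m * qpoch q q (m + s))) =
   1 / (qpoch q q M * qpoch q q (M + s))"
proof (induction M arbitrary: s)
  case 0
  show ?case by simp
next
  case (Suc M)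
  have P: "qpoch q q k \<noteq> 0" for k
    by (rule qpoch_nonzero[OF q])
  define T where "T = (\<lambda>M m s. q ^ (m * (m + s)) / (qpoch q q (M - m) * qpoch q q m *
      qpoch q q (m + s)))"
  define U where "U = (\<lambda>m. q ^ (m * (m + s) + m) / (qpoch q q (M - m) * qpoch q q m *
      qpoch q q (m + s)))"
  define V where "V = (\<lambda>m. q ^ (Suc m * (Suc m + s)) / (qpoch q q (M - m) * qpoch q q m *
      qpoch q q (Suc m + s)))"
  have nz: "1 - q ^ Suc k \<noteq> 0" for k
    by (rule one_minus_q_power_nonzero) simp
  have UV: "U m + V m = T M m (Suc s)" for m
  proof -
    have "U m = q ^ (m * (m + Suc s)) * (1 - q ^ Suc (m + s)) / (qpoch q q (M - m) * qpoch q q m *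
        qpoch q q (Suc (m + s)))"
      using P nz[of "m + s"] by (simp add: U_def qpoch_q_Suc del: power_Suc) (simp add: algebra_simps)
    moreover have "V m = q ^ (m * (m + Suc s)) * q ^ Suc (m + s) / (qpoch q q (M - m) * qpoch q q m *
        qpoch q q (Suc (m + s)))"
      by (simp add: V_def power_add[symmetric] algebra_simps)
    ultimately show ?thesis
      by (simp add: T_def add_divide_distrib[symmetric] algebra_simps)
  qed
  have sp: "(1 - q ^ Suc M) * T (Suc M) m s = (1 - q ^ (Suc M - m)) * q ^ m * T (Suc M) m s +
      (1 - q ^ m) * T (Suc M) m s"
    if "m \<le> Suc M" for m
  proof -
    have "q ^ Suc M = q ^ (Suc M - m) * q ^ m"
      using that by (simp flip: power_add)
    then show ?thesis by (simp add: algebra_simps)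
  qed
  have 1: "(1 - q ^ (Suc M - m)) * q ^ m * T (Suc M) m s = U m" if "m \<le> M" for m
    using P that nz[of "M - m"] by (simp add: T_def U_def Suc_diff_le qpoch_q_Suc power_add ac_simps
        del: power_Suc)
  have 2: "(1 - q ^ Suc m) * T (Suc M) (Suc m) s = V m" for m
    using P nz[of m] by (simp add: T_def V_def qpoch_q_Suc del: power_Suc)
  have "(1 - q ^ Suc M) * (\<Sum>m\<le>Suc M. T (Suc M) m s) =
      (\<Sum>m\<le>Suc M. (1 - q ^ (Suc M - m)) * q ^ m * T (Suc M) m s) +
          (\<Sum>m\<le>Suc M. (1 - q ^ m) * T (Suc M) m s)"
    by (simp add: sum_distrib_left sp sum.distrib del: power_Suc sum.atMost_Suc)
  \<comment> \<open>A factor \<open>1 - q^0\<close> removes the end term \<open>m = M + 1\<close>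
    here and \<open>m = 0\<close> in the next sum.\<close>
  also have "(\<Sum>m\<le>Suc M. (1 - q ^ (Suc M - m)) * q ^ m * T (Suc M) m s) = (\<Sum>m\<le>M. U m)"
    by (simp add: 1 del: power_Suc)
  also have "(\<Sum>m\<le>Suc M. (1 - q ^ m) * T (Suc M) m s) = (\<Sum>m\<le>M. V m)"
    by (subst sum.atMost_Suc_shift) (simp add: 2 del: power_Suc)
  also have "(\<Sum>m\<le>M. U m) + (\<Sum>m\<le>M. V m) = 1 / (qpoch q q M * qpoch q q (M + Suc s))"
    using Suc.IH[of "Suc s"] by (simp add: sum.distrib[symmetric] UV T_def)
  finally have main: "(1 - q ^ Suc M) * (\<Sum>m\<le>Suc M. T (Suc M) m s) =
      1 / (qpoch q q M * qpoch q q (M + Suc s))" .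
  have *: "S = 1 / (a * c * b)" if "c * S = 1 / (a * b)" "c \<noteq> 0" for a b c S :: 'a
  proof -
    have "S = c * S / c" using that(2) by simp
    then show ?thesis unfolding that(1) by (simp add: ac_simps)
  qed
  have eq: "qpoch q q (Suc M) * qpoch q q (Suc M + s) = qpoch q q M * (1 - q ^ Suc M) * qpoch q q (M + Suc s)"
    by (simp add: qpoch_q_Suc[of M])
  show ?case
    using *[OF main nz[of M]] unfolding eq T_def .
qed

text \<open>This is the q-Pascal recurrence, from
  \<open>1 - q^(n+1) = (1 - q^(n+1-k)) + q^(n+1-k) (1 - q^k)\<close>. The homogeneous form in
  \<open>u\<close> and \<open>z\<close> later allows \<open>u\<close> to be a power of the variable,
  which is not invertible as a power series.\<close>

lemma q_binomial:
  fixes u z :: 'a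
  shows "(\<Prod>k<n. u + z * q ^ k) =
    (\<Sum>k\<le>n. q ^ (k choose 2) * z ^ k * u ^ (n - k) * qpoch q q n / (qpoch q q k * qpoch q q (n - k)))"
proof (induction n)
  case 0
  show ?case by (simp add: numeral_2_eq_2)
next
  case (Suc n)
  define T where "T = (\<lambda>n k. q ^ (k choose 2) * z ^ k * u ^ (n - k) * qpoch q q n /
      (qpoch q q k * qpoch q q (n - k)))"
  have P: "qpoch q q k \<noteq> 0" for k
    by (rule qpoch_nonzero[OF q])
  have nz: "1 - q ^ Suc k \<noteq> 0" for k
    by (rule one_minus_q_power_nonzero) simp
  define c where "c = (\<lambda>k. q ^ (k choose 2) * z ^ k * u ^ (Suc n - k) * qpoch q q n /
      (qpoch q q k * qpoch q q (Suc n - k)))"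
  have T: "T (Suc n) k = (1 - q ^ (Suc n - k)) * c k + q ^ (Suc n - k) * (1 - q ^ k) * c k"
      if "k \<le> Suc n" for k
  proof -
    have "q ^ Suc n = q ^ (Suc n - k) * q ^ k"
      using that by (simp flip: power_add)
    then have "1 - q ^ Suc n = (1 - q ^ (Suc n - k)) + q ^ (Suc n - k) * (1 - q ^ k)"
      by (simp add: algebra_simps)
    moreover have "T (Suc n) k = (1 - q ^ Suc n) * c k"
      by (simp add: T_def c_def qpoch_q_Suc del: power_Suc)
    ultimately show ?thesis
      by (simp only: distrib_right)
  qed
  have 1: "(1 - q ^ (Suc n - k)) * c k = T n k * u" if "k \<le> n" for k
    using P that nz[of "n - k"] by (simp add: T_def c_def Suc_diff_le qpoch_q_Suc[of "n - k"] del: power_Suc)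
      (simp add: ac_simps)
  have 2: "q ^ (n - k) * (1 - q ^ Suc k) * c (Suc k) = T n k * (z * q ^ n)" if "k \<le> n" for k
  proof -
    have "q ^ n = q ^ (n - k) * q ^ k"
      using that by (simp flip: power_add)
    then have "q ^ (n - k) * q ^ (Suc k choose 2) * z ^ Suc k = q ^ (k choose 2) * z ^ k * (z * q ^ n)"
      by (simp add: choose_2_Suc power_add)
    moreover have "(1 - q ^ Suc k) * c (Suc k) = q ^ (Suc k choose 2) * z ^ Suc k * (u ^ (n - k) *
        qpoch q q n / (qpoch q q k * qpoch q q (n - k)))"
      using P nz[of k] by (simp add: c_def qpoch_q_Suc[of k] del: power_Suc)
    moreover have "T n k = q ^ (k choose 2) * z ^ k * (u ^ (n - k) * qpoch q q n / (qpoch q q k *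
        qpoch q q (n - k)))"
      by (simp add: T_def)
    moreover have "a * b * C = Tk * zq"
      if "a * c * d = e * f * zq" "b * C = c * d * W" "Tk = e * f * W" for a b c d e f zq C Tk W :: 'a
      using that by algebra
    ultimately show ?thesis
      by blast
  qed
  have "(\<Sum>k\<le>Suc n. T (Suc n) k) =
      (\<Sum>k\<le>Suc n. (1 - q ^ (Suc n - k)) * c k) + (\<Sum>k\<le>Suc n. q ^ (Suc n - k) * (1 - q ^ k) * c k)"
    unfolding sum.distrib[symmetric] by (rule sum.cong) (simp_all only: atMost_iff T)
  also have "(\<Sum>k\<le>Suc n. (1 - q ^ (Suc n - k)) * c k) = (\<Sum>k\<le>n. T n k * u)"
    using 1 by simp
  also have "(\<Sum>k\<le>Suc n. q ^ (Suc n - k) * (1 - q ^ k) * c k) = (\<Sum>k\<le>n. T n k * (z * q ^ n))"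
    by (subst sum.atMost_Suc_shift) (use 2 in \<open>simp del: power_Suc\<close>)
  also have "(\<Sum>k\<le>n. T n k * u) + (\<Sum>k\<le>n. T n k * (z * q ^ n)) = (\<Prod>k<n. u + z *
      q ^ k) * (u + z * q ^ n)"
    by (simp add: Suc.IH T_def sum_distrib_right distrib_left)
  finally show ?case
    unfolding T_def prod.lessThan_Suc by (rule sym)
qed

section \<open>Bailey's lemma\<close>

text \<open>Finite Bailey lemma with both parameters sent to infinity: insert the partial fractions,
  exchange the sums, and evaluate the sum over \<open>n\<close> by \<open>q_vandermonde\<close> with
  \<open>M = N - r\<close> and \<open>s = 2r + 1\<close>.\<close>

lemma bailey_transform:
  fixes x y :: 'a
  assumes xy: "x * y = q" and x: "\<And>k. x * q ^ k \<noteq> 1" and y: "\<And>k. y * q ^ k \<noteq> 1"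
  shows "(\<Sum>n\<le>N. q ^ (n * Suc n) / (qpoch q q (N - n) * (qpoch x q (Suc n) * qpoch y q (Suc n)))) =
         (\<Sum>r\<le>N. (-1) ^ r * q ^ (3 * (Suc r choose 2)) * (1 - q ^ (2 * r + 1)) /
           ((1 - x * q ^ r) * (1 - y * q ^ r) * qpoch q q (N - r) * qpoch q q (N + 1 + r)))"
proof -
  define g where "g = (\<lambda>r. (-1) ^ r * q ^ (Suc r choose 2) * (1 - q ^ (2 * r + 1)) / ((1 - x *
      q ^ r) * (1 - y * q ^ r)))"
  have inner: "(\<Sum>n\<in>{r..N}. q ^ (n * Suc n) / (qpoch q q (N - n) * qpoch q q (n - r) *
      qpoch q q (n + 1 + r))) =
      q ^ (2 * (Suc r choose 2)) / (qpoch q q (N - r) * qpoch q q (N + 1 + r))" if r: "r \<le> N" for r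
  proof -
    obtain M where N: "N = M + r"
      using le_Suc_ex[OF r] by (auto simp: add.commute)
    have c2: "2 * (Suc r choose 2) = r * Suc r"
      by (induction r) (simp_all add: choose_2_Suc numeral_2_eq_2)
    have "(\<Sum>n\<in>{r..N}. q ^ (n * Suc n) / (qpoch q q (N - n) * qpoch q q (n - r) *
        qpoch q q (n + 1 + r))) =
       (\<Sum>m\<le>M. q ^ ((m + r) * Suc (m + r)) / (qpoch q q (M - m) * qpoch q q m * qpoch q q (m +
           r + 1 + r)))"
      unfolding N by (rule sum.reindex_bij_witness[of _ "\<lambda>m. m + r" "\<lambda>n. n - r"]) auto
    \<comment> \<open>Here \<open>(m+r)(m+r+1) = r(r+1) + m(m+2r+1)\<close>.\<close>
    also have "\<dots> = q ^ (r * Suc r) * (\<Sum>m\<le>M. q ^ (m * (m + (2 * r + 1))) /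
        (qpoch q q (M - m) * qpoch q q m * qpoch q q (m + (2 * r + 1))))"
      unfolding sum_distrib_left
      by (rule sum.cong) (simp_all add: power_add[symmetric] algebra_simps mult_2 mult_2_right)
    also have "\<dots> = q ^ (r * Suc r) / (qpoch q q (N - r) * qpoch q q (N + 1 + r))"
      unfolding q_vandermonde N by (simp add: mult_2 add_ac)
    finally show ?thesis
      by (simp only: c2)
  qed
  have "(\<Sum>n\<le>N. q ^ (n * Suc n) / (qpoch q q (N - n) * (qpoch x q (Suc n) * qpoch y q (Suc n)))) =
      (\<Sum>n\<le>N. \<Sum>r\<le>n. g r * (q ^ (n * Suc n) / (qpoch q q (N - n) * qpoch q q (n - r) *
          qpoch q q (n + 1 + r))))"
  proof (rule sum.cong[OF refl])
    fix n
    have "q ^ (n * Suc n) / (qpoch q q (N - n) * (qpoch x q (Suc n) * qpoch y q (Suc n))) =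
        q ^ (n * Suc n) / qpoch q q (N - n) * (1 / (qpoch x q (Suc n) * qpoch y q (Suc n)))"
      by simp
    then show "q ^ (n * Suc n) / (qpoch q q (N - n) * (qpoch x q (Suc n) * qpoch y q (Suc n))) =
        (\<Sum>r\<le>n. g r * (q ^ (n * Suc n) / (qpoch q q (N - n) * qpoch q q (n - r) *
            qpoch q q (n + 1 + r))))"
      unfolding inverse_qpoch_partial_fractions[OF assms] sum_distrib_left
      by (simp add: g_def ac_simps)
  qed
  also have "\<dots> = (\<Sum>r\<le>N. \<Sum>n\<in>{r..N}. g r * (q ^ (n * Suc n) /
      (qpoch q q (N - n) * qpoch q q (n - r) * qpoch q q (n + 1 + r))))"
    unfolding sum.Sigma[OF finite_atMost ballI[OF finite_atMost]] sum.Sigma[OF finite_atMost ballI[OF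
        finite_atLeastAtMost]]
    by (rule sum.reindex_bij_witness[of _ prod.swap prod.swap]) auto
  also have "\<dots> = (\<Sum>r\<le>N. g r * (q ^ (2 * (Suc r choose 2)) / (qpoch q q (N - r) *
      qpoch q q (N + 1 + r))))"
    by (rule sum.cong) (simp_all only: atMost_iff sum_distrib_left[symmetric] inner)
  also have "\<dots> = (\<Sum>r\<le>N. (-1) ^ r * q ^ (3 * (Suc r choose 2)) * (1 - q ^ (2 * r + 1)) /
           ((1 - x * q ^ r) * (1 - y * q ^ r) * qpoch q q (N - r) * qpoch q q (N + 1 + r)))"
  proof (rule sum.cong[OF refl])
    fix r
    have "q ^ (3 * (Suc r choose 2)) = q ^ (Suc r choose 2) * q ^ (2 * (Suc r choose 2))"
      by (simp flip: power_add)
    then show "g r * (q ^ (2 * (Suc r choose 2)) / (qpoch q q (N - r) * qpoch q q (N + 1 + r))) =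
        (-1) ^ r * q ^ (3 * (Suc r choose 2)) * (1 - q ^ (2 * r + 1)) /
           ((1 - x * q ^ r) * (1 - y * q ^ r) * qpoch q q (N - r) * qpoch q q (N + 1 + r))"
      by (simp add: g_def ac_simps)
  qed
  finally show ?thesis .
qed

end

subsection \<open>Transfer to formal power series\<close>

lemma fps_to_fls_qpoch:
  "fps_to_fls (qpoch a q n) = qpoch (fps_to_fls a) (fps_to_fls q) n"
  by (induction n) (simp_all add: qpoch_Suc fls_times_fps_to_fls fps_to_fls_power)

lemma fps_to_fls_inverse:
  fixes f :: "'a :: field fps"
  assumes "f $ 0 \<noteq> 0"
  shows "fps_to_fls (inverse f) = inverse (fps_to_fls f)"
  using assms by (simp add: fls_inverse_fps_to_fls subdegree_eq_0_iff)

lemma fps_to_fls_sum: "fps_to_fls (\<Sum>i\<in>A. f i) = (\<Sum>i\<in>A. fps_to_fls (f i))"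
  by (induction A rule: infinite_finite_induct) simp_all

lemma fps_to_fls_prod:
  fixes f :: "'b \<Rightarrow> 'a :: comm_ring_1 fps"
  shows "fps_to_fls (\<Prod>i\<in>A. f i) = (\<Prod>i\<in>A. fps_to_fls (f i))"
  by (induction A rule: infinite_finite_induct) (simp_all add: fls_times_fps_to_fls)

lemmas fps_to_fls_hom = fls_times_fps_to_fls fps_to_fls_power fps_to_fls_qpoch fps_to_fls_inverse
  fps_to_fls_sum fps_to_fls_prod

lemma qpoch_nth_0_1:
  fixes a q :: "'a :: comm_ring_1 fps"
  assumes "a $ 0 = 0"
  shows "qpoch a q n $ 0 = 1"
  by (induction n) (simp_all add: qpoch_Suc assms)

text \<open>Supplies the nonvanishing hypotheses of the field identities.\<close>

lemma fps_to_fls_mult_power_neq_1: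
  fixes a q :: "'a :: comm_ring_1 fps"
  assumes "a $ 0 = 0"
  shows "fps_to_fls a * fps_to_fls q ^ k \<noteq> 1"
proof -
  have "(a * q ^ k) $ 0 \<noteq> 1 $ 0"
    using assms by simp
  then have "fps_to_fls (a * q ^ k) \<noteq> fps_to_fls 1"
    unfolding fps_to_fls_eq_iff by metis
  then show ?thesis
    by (simp add: fls_times_fps_to_fls fps_to_fls_power)
qed

context
  fixes q :: "'a :: field fps"
  assumes q: "q $ 0 = 0"
begin

text \<open>Laurent series form a field, so the identity holds there, and it descends because
  \<open>fps_to_fls\<close> is injective. The denominators have constant coefficient 1, hence
  \<open>inverse\<close> is the true inverse on both sides.\<close>

lemma fps_q_binomial:
  "(\<Prod>k<n. u + z * q ^ k) =
    (\<Sum>k\<le>n. q ^ (k choose 2) * z ^ k * u ^ (n - k) * qpoch q q n * inverse (qpoch q q k *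
        qpoch q q (n - k)))"
proof (rule fps_to_fls_eq_imp_fps_eq)
  show "fps_to_fls (\<Prod>k<n. u + z * q ^ k) = fps_to_fls (\<Sum>k\<le>n. q ^ (k choose 2) * z ^ k *
      u ^ (n - k) * qpoch q q n * inverse (qpoch q q k * qpoch q q (n - k)))"
    using q_binomial[OF fps_to_fls_mult_power_neq_1[OF q], of "fps_to_fls u" "fps_to_fls z" n]
    by (simp add: fps_to_fls_hom qpoch_nth_0_1 q divide_inverse)
qed

context
  fixes x y :: "'a fps"
  assumes xy: "x * y = q" and x: "x $ 0 = 0" and y: "y $ 0 = 0"
begin

lemma fps_to_fls_xy: "fps_to_fls x * fps_to_fls y = fps_to_fls q"
  by (simp add: xy[symmetric] fls_times_fps_to_fls)

lemma fps_inverse_qpoch_partial_fractions: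
  "inverse (qpoch x q (Suc n) * qpoch y q (Suc n)) =
   (\<Sum>r\<le>n. (-1) ^ r * q ^ (Suc r choose 2) * (1 - q ^ (2 * r + 1)) *
      inverse ((1 - x * q ^ r) * (1 - y * q ^ r)) * inverse (qpoch q q (n - r) * qpoch q q (n + 1 + r)))"
  (is "?l = ?r")
proof (rule fps_to_fls_eq_imp_fps_eq)
  show "fps_to_fls ?l = fps_to_fls ?r"
    using inverse_qpoch_partial_fractions[OF fps_to_fls_mult_power_neq_1[OF q] fps_to_fls_xy
        fps_to_fls_mult_power_neq_1[OF x] fps_to_fls_mult_power_neq_1[OF y], of n]
    by (simp add: fps_to_fls_hom qpoch_nth_0_1 q x y divide_inverse mult.assoc)
qed

lemma fps_bailey_transform:
  "(\<Sum>n\<le>N. q ^ (n * Suc n) * inverse (qpoch q q (N - n) * (qpoch x q (Suc n) * qpoch y q (Suc n)))) =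
   (\<Sum>r\<le>N. (-1) ^ r * q ^ (3 * (Suc r choose 2)) * (1 - q ^ (2 * r + 1)) *
      inverse ((1 - x * q ^ r) * (1 - y * q ^ r)) * inverse (qpoch q q (N - r) * qpoch q q (N + 1 + r)))"
  (is "?l = ?r")
proof (rule fps_to_fls_eq_imp_fps_eq)
  show "fps_to_fls ?l = fps_to_fls ?r"
    using bailey_transform[OF fps_to_fls_mult_power_neq_1[OF q] fps_to_fls_xy
        fps_to_fls_mult_power_neq_1[OF x] fps_to_fls_mult_power_neq_1[OF y], of N]
    by (simp add: fps_to_fls_hom qpoch_nth_0_1 q x y divide_inverse mult.assoc)
qed

end

end

subsection \<open>Truncation and trisection\<close>

text \<open>Congruence modulo the \<open>N\<close>-th power of the variable; finite products taken
  up to this relation stand in for the infinite ones.\<close>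

definition fps_cong :: "nat \<Rightarrow> 'a :: comm_ring_1 fps \<Rightarrow> 'a fps \<Rightarrow> bool" where
  "fps_cong N f g \<longleftrightarrow> (\<forall>i<N. f $ i = g $ i)"

lemma fps_cong_refl [simp]: "fps_cong N f f"
  by (simp add: fps_cong_def)

lemma fps_cong_sym: "fps_cong N f g \<Longrightarrow> fps_cong N g f"
  by (simp add: fps_cong_def)

lemma fps_cong_trans [trans]: "fps_cong N f g \<Longrightarrow> fps_cong N g h \<Longrightarrow> fps_cong N f h"
  by (simp add: fps_cong_def)

lemma fps_cong_mult:
  "fps_cong N f g \<Longrightarrow> fps_cong N h k \<Longrightarrow> fps_cong N (f * h) (g * k)"
  unfolding fps_cong_def fps_mult_nth by (intro allI impI sum.cong) simp_all

lemma fps_cong_sum: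
  "(\<And>i. i \<in> A \<Longrightarrow> fps_cong N (f i) (g i)) \<Longrightarrow>
      fps_cong N (\<Sum>i\<in>A. f i) (\<Sum>i\<in>A. g i)"
  by (simp add: fps_cong_def fps_sum_nth)

lemma fps_cong_inverse:
  fixes f g :: "'a :: field fps"
  assumes "fps_cong N f g" "f $ 0 \<noteq> 0" "g $ 0 \<noteq> 0"
  shows "fps_cong N (inverse f) (inverse g)"
proof -
  have "fps_cong N (inverse f * inverse g * g) (inverse f * inverse g * f)"
    by (rule fps_cong_mult[OF fps_cong_refl fps_cong_sym[OF assms(1)]])
  moreover have "inverse f * inverse g * g = inverse f" "inverse f * inverse g * f = inverse g"
    using inverse_mult_eq_1[OF assms(2)] inverse_mult_eq_1[OF assms(3)]
    by (simp_all add: mult.assoc mult.left_commute[of "inverse f"])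
  ultimately show ?thesis
    by simp
qed

lemma fps_cong_X_power_mult:
  "fps_cong M f g \<Longrightarrow> N \<le> a + M \<Longrightarrow> fps_cong N (fps_X ^ a * f) (fps_X ^ a * g)"
  by (simp add: fps_cong_def fps_X_power_mult_nth)

text \<open>Every factor beyond the first \<open>n\<close> differs from 1 only in degree
  \<open>a + b n\<close> or higher.\<close>

lemma qpoch_fps_cong:
  assumes "n \<le> m" "N \<le> a + b * n"
  shows "fps_cong N (qpoch (fps_X ^ a) (fps_X ^ b) m) (qpoch (fps_X ^ a) (fps_X ^ b) n)"
  using assms(1)
proof (induction rule: dec_induct)
  case base
  show ?case by simp
next
  case (step k)
  have "N \<le> a + b * k"
    using assms(2) step.hyps(1) by (meson add_left_mono le_trans mult_le_mono2)
  then have "fps_cong N (1 - fps_X ^ a * (fps_X ^ b) ^ k :: 'a fps) 1"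
    by (simp add: fps_cong_def flip: power_mult power_add)
  then show ?case
    using fps_cong_mult[OF step.IH] by (fastforce simp: qpoch_Suc)
qed

section \<open>Extraction of the exponents divisible by 3\<close>

definition trisect :: "'a fps \<Rightarrow> 'a fps" where
  "trisect f = Abs_fps (\<lambda>k. f $ (3 * k))"

lemma trisect_nth [simp]: "trisect f $ k = f $ (3 * k)"
  by (simp add: trisect_def)

lemma trisect_add: "trisect (f + g) = trisect f + trisect g"
  and trisect_diff: "trisect (h - k) = trisect h - trisect k"
  and trisect_1 [simp]: "trisect 1 = 1"
  by (simp_all add: fps_eq_iff)

lemma trisect_sum: "trisect (\<Sum>i\<in>A. f i) = (\<Sum>i\<in>A. trisect (f i))"
  by (simp add: fps_eq_iff fps_sum_nth)

text \<open>Series in the cube of the variable act as scalars: in the Cauchy product their exponents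
  are multiples of 3, so only such exponents of \<open>g\<close> contribute.\<close>

lemma trisect_compose_mult:
  fixes f g :: "'a :: comm_ring_1 fps"
  shows "trisect ((f oo fps_X ^ 3) * g) = f * trisect g"
proof (rule fps_ext)
  fix k
  have "trisect ((f oo fps_X ^ 3) * g) $ k = (\<Sum>i=0..3*k. (f oo fps_X ^ 3) $ i * g $ (3 * k - i))"
    by (simp add: fps_mult_nth)
  also have "\<dots> = (\<Sum>i\<in>(*) 3 ` {0..k}. (f oo fps_X ^ 3) $ i * g $ (3 * k - i))"
    by (rule sum.mono_neutral_right) (auto simp: fps_nth_compose_X_power image_iff elim!: dvdE)
  also have "\<dots> = (\<Sum>j=0..k. f $ j * g $ (3 * (k - j)))"
    by (subst sum.reindex) (auto simp: inj_on_def fps_nth_compose_X_power diff_mult_distrib2)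
  finally show "trisect ((f oo fps_X ^ 3) * g) $ k = (f * trisect g) $ k"
    by (simp add: fps_mult_nth)
qed

lemma fps_X_power_compose_cube: "fps_X ^ a oo fps_X ^ 3 = (fps_X ^ (3 * a) :: 'a :: idom fps)"
  by (simp add: fps_X_power_compose power_mult)

text \<open>Over the denominator \<open>1 - q^(3a)\<close> the numerator is
  \<open>1 + q^a + q^(2a)\<close>, of which only the 1 survives extraction.\<close>

lemma trisect_geometric:
  assumes "\<not> 3 dvd a"
  shows "trisect (inverse (1 - fps_X ^ a)) = (inverse (1 - fps_X ^ a) :: 'a :: field fps)"
proof -
  have a: "a > 0"
    using assms by (cases a) auto
  let ?f = "1 - fps_X ^ a :: 'a fps" and ?h = "1 + fps_X ^ a + fps_X ^ (2 * a) :: 'a fps"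
  have f: "?f $ 0 \<noteq> 0"
    using a by simp
  have "inverse ?f oo fps_X ^ 3 = inverse (?f oo fps_X ^ 3)"
    using f by (intro fps_inverse_compose) simp_all
  also have "?f oo fps_X ^ 3 = ?f * ?h"
  proof -
    have "(1 - y ^ 3) = (1 - y) * (1 + y + y\<^sup>2)" for y :: "'a fps"
      by algebra
    then show ?thesis
      by (simp add: fps_compose_sub_distrib fps_X_power_compose_cube mult.commute[of _ a] power_mult)
  qed
  also have "inverse (?f * ?h) = inverse ?f * inverse ?h"
    by (rule fps_inverse_mult)
  finally have "(inverse ?f oo fps_X ^ 3) * ?h = inverse ?f * (inverse ?h * ?h)"
    by (simp add: mult.assoc)
  also have "inverse ?h * ?h = 1"
    using a by (intro inverse_mult_eq_1) simp
  finally have "trisect (inverse ?f) = inverse ?f * trisect ?h"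
    using trisect_compose_mult[of "inverse ?f" ?h] by simp
  also have "trisect ?h = 1"
  proof (rule fps_ext)
    fix k
    have "3 * k \<noteq> a" "3 * k \<noteq> 2 * a"
      using assms by presburger+
    then show "trisect ?h $ k = 1 $ k"
      by simp
  qed
  finally show ?thesis
    by simp
qed

text \<open>With \<open>A = 1 - q^a\<close> and \<open>B = 1 - q^b\<close> one has
  \<open>1 - q^(a+b) = A + B - A B\<close>, so the quotient is \<open>1/A + 1/B - 1\<close>, a
  combination of series fixed by \<open>trisect\<close>.\<close>

lemma trisect_geometric_pair:
  assumes "\<not> 3 dvd a" "\<not> 3 dvd b"
  shows "trisect ((1 - fps_X ^ (a + b)) * inverse ((1 - fps_X ^ a) * (1 - fps_X ^ b))) =
    ((1 - fps_X ^ (a + b)) * inverse ((1 - fps_X ^ a) * (1 - fps_X ^ b)) :: 'a :: field fps)"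
proof -
  have "a > 0" "b > 0"
    using assms by (auto intro!: gr0I)
  define A B :: "'a fps" where "A = 1 - fps_X ^ a" and "B = 1 - fps_X ^ b"
  have AB: "inverse A * A = 1" "inverse B * B = 1"
    unfolding A_def B_def using \<open>a > 0\<close> \<open>b > 0\<close> by (auto intro!: inverse_mult_eq_1)
  have "(1 - fps_X ^ (a + b)) = A + B - A * B"
    by (simp add: A_def B_def algebra_simps power_add)
  then have "(1 - fps_X ^ (a + b)) * inverse (A * B) = (A + B - A * B) * (inverse A * inverse B)"
    by (simp only: fps_inverse_mult)
  also have "\<dots> = inverse A + inverse B - 1"
    using AB by algebra
  finally show ?thesis
    unfolding A_def B_def by (simp add: trisect_add trisect_diff trisect_geometric assms)
qed

lemma qpoch_compose_cube:
  "qpoch (fps_X ^ (3 * a)) (fps_X ^ (3 * b)) n = (qpoch (fps_X ^ a) (fps_X ^ b) n :: 'a :: field fps)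
      oo fps_X ^ 3"
  by (induction n)
    (simp_all add: qpoch_Suc fps_compose_mult_distrib fps_compose_sub_distrib fps_X_power_compose_cube
      flip: power_mult power_add)

subsection \<open>Power series over the field with two elements\<close>

text \<open>As a simplification rule this also erases the signs \<open>(-1)^r\<close> of the Bailey
  sums.\<close>

lemma bit_fps_uminus [simp]: "- f = (f :: bit fps)"
  by (simp add: fps_eq_iff)

lemma bit_fps_add_self: "f + f = (0 :: bit fps)"
  by (rule fps_ext) (simp only: fps_add_nth fps_zero_nth, simp)

lemma bit_fps_diff: "f - g = (f + g :: bit fps)"
  by (simp add: fps_eq_iff)

lemma bit_fps_power2_diff: "(f - g)\<^sup>2 = (f\<^sup>2 - g\<^sup>2 :: bit fps)"
proof -
  have "2 * f * g = f * g + f * g"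
    by (simp add: algebra_simps)
  then have "2 * f * g = 0"
    by (simp only: bit_fps_add_self)
  then show ?thesis
    using power2_diff[of f g] by (simp add: bit_fps_diff)
qed

text \<open>Frobenius in characteristic 2, factor by factor.\<close>

lemma bit_qpoch_power2:
  fixes a q :: "bit fps"
  shows "(qpoch a q n)\<^sup>2 = qpoch (a\<^sup>2) (q\<^sup>2) n"
  by (induction n)
    (simp_all add: qpoch_Suc power_mult_distrib bit_fps_power2_diff power_mult[symmetric] mult.commute)

lemma qpoch_X_nth_0 [simp]:
  "a > 0 \<Longrightarrow> qpoch (fps_X ^ a) q n $ 0 = (1 :: 'a :: comm_ring_1)"
  "qpoch fps_X q n $ 0 = (1 :: 'a :: comm_ring_1)"
  by (simp_all add: qpoch_nth_0_1)

section \<open>Dissections of products and Euler's identity modulo 2\<close>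

lemma qpoch_split_2: "qpoch q q (2 * n) = qpoch q (q\<^sup>2) n * qpoch (q\<^sup>2) (q\<^sup>2) n"
proof (induction n)
  case (Suc n)
  have "q * q ^ (2 * n) = q * (q\<^sup>2) ^ n" "q * q ^ Suc (2 * n) = q\<^sup>2 * (q\<^sup>2) ^ n"
    by (simp_all add: power_mult power2_eq_square)
  then show ?case
    using Suc by (simp add: qpoch_Suc)
qed simp

lemma qpoch_split_3: "qpoch a q (3 * n) = qpoch a (q ^ 3) n * qpoch (a * q) (q ^ 3) n * qpoch (a *
    q\<^sup>2) (q ^ 3) n"
proof (induction n)
  case (Suc n)
  have "3 * Suc n = Suc (Suc (Suc (3 * n)))"
    by simp
  moreover have "a * q ^ (3 * n) = a * (q ^ 3) ^ n" "a * q ^ Suc (3 * n) = a * q * (q ^ 3) ^ n"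
    "a * q ^ Suc (Suc (3 * n)) = a * q\<^sup>2 * (q ^ 3) ^ n"
    by (simp_all add: power_mult power2_eq_square)
  ultimately show ?case
    using Suc by (simp only: qpoch_Suc) (simp only: ac_simps)
qed simp

text \<open>Put \<open>t = q^d\<close>. Modulo 2,
  \<open>(t;t)_2N = (t;t^2)_N (t^2;t^2)_N = (t;t^2)_N (t;t)_N^2\<close>, and the left side is
  congruent to \<open>(t;t)_N\<close>; one factor \<open>(t;t)_N\<close> cancels.\<close>

lemma bit_euler:
  assumes "d > 0"
  shows "fps_cong N (qpoch (fps_X ^ d) (fps_X ^ d) N * qpoch (fps_X ^ d) (fps_X ^ (2 * d)) N) (1 :: bit fps)"
proof -
  define q where "q = (fps_X ^ d :: bit fps)"
  define Q where "Q = qpoch q q N"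
  have Q0: "Q $ 0 = 1"
    using assms by (simp add: Q_def q_def)
  have N: "N \<le> d + d * N"
    using assms by (simp add: trans_le_add2)
  have "fps_cong N Q (qpoch q q (2 * N))"
    unfolding Q_def q_def by (rule fps_cong_sym, rule qpoch_fps_cong) (use N in auto)
  also have "qpoch q q (2 * N) = qpoch q (q\<^sup>2) N * Q\<^sup>2"
    by (simp add: qpoch_split_2 bit_qpoch_power2 Q_def)
  finally have "fps_cong N (inverse Q * (qpoch q (q\<^sup>2) N * Q\<^sup>2)) (inverse Q * Q)"
    by (intro fps_cong_mult[OF fps_cong_refl] fps_cong_sym[of N Q])
  moreover have "inverse Q * Q = 1"
    by (rule inverse_mult_eq_1) (simp add: Q0)
  moreover have "inverse Q * (qpoch q (q\<^sup>2) N * Q\<^sup>2) = (inverse Q * Q) * (Q * qpoch q (q\<^sup>2) N)"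
    unfolding power2_eq_square by (simp only: ac_simps)
  ultimately have "fps_cong N (Q * qpoch q (q\<^sup>2) N) 1"
    by simp
  moreover have "q\<^sup>2 = fps_X ^ (2 * d)"
    by (simp add: q_def mult.commute flip: power_mult)
  ultimately show ?thesis
    by (simp only: Q_def q_def)
qed

text \<open>Euler's identity for \<open>q^2\<close> reads \<open>R D^2 C = 1\<close> and for
  \<open>q^6\<close> it reads \<open>P C = 1\<close>; comparing the two ways to evaluate
  \<open>P R D^2 C\<close> eliminates \<open>C\<close>.\<close>

lemma bit_product_congruence:
  "fps_cong N (qpoch (fps_X ^ 6) (fps_X ^ 6) N)
     (qpoch (fps_X ^ 2) (fps_X ^ 2) N * (qpoch fps_X (fps_X ^ 6) N *
         qpoch (fps_X ^ 5) (fps_X ^ 6) N)\<^sup>2 :: bit fps)"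
proof -
  define R P C D where "R = (qpoch (fps_X ^ 2) (fps_X ^ 2) N :: bit fps)"
    and "P = (qpoch (fps_X ^ 6) (fps_X ^ 6) N :: bit fps)"
    and "C = (qpoch (fps_X ^ 6) (fps_X ^ 12) N :: bit fps)"
    and "D = (qpoch fps_X (fps_X ^ 6) N * qpoch (fps_X ^ 5) (fps_X ^ 6) N :: bit fps)"
  have D2: "D\<^sup>2 = qpoch (fps_X ^ 2) (fps_X ^ 12) N * qpoch (fps_X ^ 10) (fps_X ^ 12) N"
    by (simp add: D_def power_mult_distrib bit_qpoch_power2 flip: power_mult)
  \<comment> \<open>The exponents that are 2 modulo 4 fall into the classes 2, 6 and 10 modulo
    12.\<close>
  have "qpoch (fps_X ^ 2) (fps_X ^ 4) (3 * N) = D\<^sup>2 * (C :: bit fps)"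
    unfolding qpoch_split_3 D2 C_def by (simp flip: power_mult power_add)
  moreover have "fps_cong N (qpoch (fps_X ^ 2) (fps_X ^ 4) (3 *
      N)) (qpoch (fps_X ^ 2) (fps_X ^ 4) N :: bit fps)"
    by (rule qpoch_fps_cong) auto
  ultimately have "fps_cong N (R * (D\<^sup>2 * C)) (R * qpoch (fps_X ^ 2) (fps_X ^ 4) N)"
    by (simp add: fps_cong_mult)
  also have "fps_cong N \<dots> 1"
    using bit_euler[of 2 N] by (simp add: R_def)
  finally have RDC: "fps_cong N (R * (D\<^sup>2 * C)) 1" .
  have "fps_cong N (P * C) 1"
    using bit_euler[of 6 N] by (simp add: P_def C_def)
  then have "fps_cong N (P * C * (R * D\<^sup>2)) (1 * (R * D\<^sup>2))"
    by (rule fps_cong_mult) simp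
  moreover have "fps_cong N (P * (R * (D\<^sup>2 * C))) (P * 1)"
    by (rule fps_cong_mult[OF fps_cong_refl RDC])
  ultimately have "fps_cong N P (R * D\<^sup>2)"
    by (simp add: fps_cong_def ac_simps)
  then show ?thesis
    by (simp add: P_def R_def D_def)
qed

section \<open>Replacing shifted product lengths by \<open>N\<close>\<close>

text \<open>Shortening the product by \<open>r\<close> factors keeps agreement at least up to degree
  \<open>N - r\<close>; the prefactor of degree \<open>c\<close>, at least \<open>r\<close>,
  restores precision \<open>N\<close>.\<close>

lemma qpoch_near_N_cong:
  fixes f :: "'a :: field fps"
  assumes "b > 0" "r \<le> N" "r \<le> c"
  defines "Q \<equiv> qpoch (fps_X ^ b) (fps_X ^ b)"
  shows "fps_cong N (fps_X ^ c * (f * inverse (Q (N - r) * Q m))) (fps_X ^ c * (f * inverse (Q N * Q m)))"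
proof (rule fps_cong_X_power_mult)
  have Q0: "Q k $ 0 = 1" for k
    using assms(1) by (simp add: Q_def)
  have "fps_cong (N - r) (Q N) (Q (N - r))"
    unfolding Q_def by (rule qpoch_fps_cong) (use assms(1) in \<open>auto simp: trans_le_add2\<close>)
  then show "fps_cong (N - r) (f * inverse (Q (N - r) * Q m)) (f * inverse (Q N * Q m))"
    using Q0 by (intro fps_cong_mult fps_cong_refl fps_cong_inverse) (auto intro: fps_cong_sym)
  show "N \<le> c + (N - r)"
    using assms by simp
qed

lemma qpoch_beyond_N_cong:
  assumes "b > 0" "m \<ge> N"
  defines "Q \<equiv> qpoch (fps_X ^ b) (fps_X ^ b)"
  shows "fps_cong N (Q m) (Q N)"
  unfolding Q_def by (rule qpoch_fps_cong) (use assms(1,2) in \<open>auto simp: trans_le_add2\<close>)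

subsection \<open>The theta series\<close>

text \<open>
  The exponent \<open>3r^2 - 2r\<close> for \<open>r = k - N\<close>, so that \<open>r\<close> runs from \<open>-N\<close> to \<open>N\<close> as \<open>k\<close> runs from
  0 to \<open>2N\<close>.
\<close>

definition theta_exponent :: "nat \<Rightarrow> nat \<Rightarrow> nat" where
  "theta_exponent N k = nat (3 * (int k - int N)\<^sup>2 - 2 * (int k - int N))"

text \<open>Ensures that \<open>nat\<close> in \<open>theta_exponent\<close> does not truncate, and
  that the exponent is large enough for \<open>qpoch_near_N_cong\<close>.\<close>

lemma abs_le_theta_form: "\<bar>r\<bar> \<le> 3 * r\<^sup>2 - 2 * r" for r :: int
proof -
  have "\<bar>r\<bar> * 1 \<le> \<bar>r\<bar> * \<bar>r\<bar>" if "r \<noteq> 0"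
    using that by (intro mult_left_mono) auto
  then have "\<bar>r\<bar> \<le> r\<^sup>2"
    by (cases "r = 0") (simp_all add: power2_eq_square)
  then show ?thesis
    by linarith
qed

lemma theta_exponent_eq:
  "int (theta_exponent N k) = 3 * (int k - int N)\<^sup>2 - 2 * (int k - int N)"
  unfolding theta_exponent_def using abs_le_theta_form[of "int k - int N"] by linarith

lemma theta_exponent_ge: "\<bar>int k - int N\<bar> \<le> int (theta_exponent N k)"
  unfolding theta_exponent_eq by (rule abs_le_theta_form)

lemma choose_2_double: "2 * int (k choose 2) = int k * (int k - 1)"
  by (induction k) (simp_all add: choose_2_Suc numeral_2_eq_2 algebra_simps)

text \<open>Degree count for the \<open>k\<close>-th term of the q-binomial expansion with base
  \<open>q^6\<close> and \<open>u = q^(6n+5)\<close>: completing the square about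
  \<open>k = n + 1\<close> leaves a part independent of \<open>k\<close> plus the theta
  exponent.\<close>

lemma theta_exponent_shift:
  assumes "k \<le> 2 * Suc n"
  shows "6 * (k choose 2) + (6 * n + 5) * (2 * Suc n - k) =
    6 * (Suc n choose 2) + (6 * n + 5) * Suc n + theta_exponent (Suc n) k"
proof -
  obtain l where l: "2 * Suc n = k + l"
    using le_Suc_ex[OF assms] by blast
  then have "int (2 * Suc n) = int (k + l)"
    by (simp only:)
  then have l': "int l = 2 * int n + 2 - int k"
    by simp
  have "int (6 * (k choose 2) + (6 * n + 5) * l) =
      int (6 * (Suc n choose 2) + (6 * n + 5) * Suc n + theta_exponent (Suc n) k)"
    using choose_2_double[of k] choose_2_double[of "Suc n"] theta_exponent_eq[of "Suc n" k]
    by (simp add: l' algebra_simps power2_eq_square)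
  then show ?thesis
    by (simp only: of_nat_eq_iff l add_diff_cancel_left')
qed

lemma prod_lessThan_add:
  fixes f :: "nat \<Rightarrow> 'a :: comm_monoid_mult"
  shows "(\<Prod>k<m + n. f k) = (\<Prod>k<m. f k) * (\<Prod>k<n. f (m + k))"
  by (induction n) (simp_all add: mult.assoc)

text \<open>A product of \<open>2N\<close> consecutive factors is expanded by
  \<open>fps_q_binomial\<close>. Its lower half gives \<open>(q^5;q^6)_N\<close> in reverse order,
  its upper half \<open>(q;q^6)_N\<close>, and a common power of the variable cancels.\<close>

lemma bit_finite_triple_product:
  assumes "N > 0"
  defines "P \<equiv> qpoch (fps_X ^ 6) (fps_X ^ 6)"
  shows "qpoch fps_X (fps_X ^ 6) N * qpoch (fps_X ^ 5) (fps_X ^ 6) N =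
    (\<Sum>k\<le>2 * N. fps_X ^ theta_exponent N k * (P (2 * N) * inverse (P k * P (2 * N - k))) :: bit fps)"
proof -
  obtain n where N: "N = Suc n"
    using assms(1) gr0_implies_Suc by blast
  define c where "c = 6 * (N choose 2) + (6 * n + 5) * N"
  \<comment> \<open>The exponent \<open>6n + 5 = 6N - 1\<close> lies between those of factors
    \<open>N - 1\<close> and \<open>N\<close>, so the lower term of each factor changes sides
    exactly at the middle.\<close>
  define f where "f = (\<lambda>k. fps_X ^ (6 * n + 5) + 1 * (fps_X ^ 6) ^ k :: bit fps)"
  have "f k = fps_X ^ (6 * k) * (1 - fps_X ^ 5 * (fps_X ^ 6) ^ (N - Suc k))" if "k < N" for k
  proof -
    have "6 * n + 5 = 6 * k + (5 + 6 * (N - Suc k))"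
      using that by (simp add: N)
    then have "(fps_X ^ (6 * n + 5) :: bit fps) = fps_X ^ (6 * k) * (fps_X ^ 5 * (fps_X ^ 6) ^ (N - Suc k))"
      by (simp add: power_add power_mult)
    then show ?thesis
      by (simp only: f_def bit_fps_diff distrib_left mult_1 mult_1_right add.commute flip: power_mult)
  qed
  then have "(\<Prod>k<N. f k) = (\<Prod>k<N. fps_X ^ (6 * k)) * (\<Prod>k<N. 1 - fps_X ^ 5 *
      (fps_X ^ 6) ^ (N - Suc k))"
    by (simp add: prod.distrib)
  also have "(\<Prod>k<N. fps_X ^ (6 * k)) = (fps_X ^ (6 * (N choose 2)) :: bit fps)"
    by (induction N) (simp_all add: numeral_2_eq_2 choose_2_Suc[unfolded numeral_2_eq_2] power_add)
  also have "(\<Prod>k<N. 1 - fps_X ^ 5 * (fps_X ^ 6) ^ (N - Suc k)) =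
      qpoch (fps_X ^ 5) (fps_X ^ 6 :: bit fps) N"
    unfolding qpoch_def by (rule prod.nat_diff_reindex)
  finally have 1: "(\<Prod>k<N. f k) = fps_X ^ (6 * (N choose 2)) * qpoch (fps_X ^ 5) (fps_X ^ 6) N" .
  have "f (N + k) = fps_X ^ (6 * n + 5) * (1 - fps_X * (fps_X ^ 6) ^ k)" for k
    by (simp add: f_def N bit_fps_diff algebra_simps power_add power_mult eval_nat_numeral)
  then have 2: "(\<Prod>k<N. f (N + k)) = fps_X ^ ((6 * n + 5) * N) * qpoch fps_X (fps_X ^ 6) N"
    by (simp add: prod.distrib qpoch_def power_mult)
  have "fps_X ^ c * (qpoch fps_X (fps_X ^ 6) N * qpoch (fps_X ^ 5) (fps_X ^ 6) N) = (\<Prod>k<2 * N. f k)"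
    unfolding mult_2 prod_lessThan_add 1 2 by (simp add: c_def power_add ac_simps)
  also have "\<dots> = (\<Sum>k\<le>2 * N. (fps_X ^ 6) ^ (k choose 2) * 1 ^ k * (fps_X ^ (6 * n +
      5)) ^ (2 * N - k) *
      P (2 * N) * inverse (P k * P (2 * N - k)))"
    unfolding f_def P_def by (rule fps_q_binomial) simp
  also have "\<dots> = (\<Sum>k\<le>2 * N. fps_X ^ c * (fps_X ^ theta_exponent N k * (P (2 * N) *
      inverse (P k * P (2 * N - k)))))"
  proof (rule sum.cong[OF refl])
    fix k assume "k \<in> {..2 * N}"
    then have "6 * (k choose 2) + (6 * n + 5) * (2 * N - k) = c + theta_exponent N k"
      unfolding c_def N by (intro theta_exponent_shift) simp
    then have "(fps_X ^ 6) ^ (k choose 2) * 1 ^ k * (fps_X ^ (6 * n + 5)) ^ (2 * N - k) = (fps_X ^ c *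
        fps_X ^ theta_exponent N k :: bit fps)"
      by (simp flip: power_mult power_add)
    then show "(fps_X ^ 6) ^ (k choose 2) * 1 ^ k * (fps_X ^ (6 * n + 5)) ^ (2 * N - k) *
        P (2 * N) * inverse (P k * P (2 * N - k)) =
        fps_X ^ c * (fps_X ^ theta_exponent N k * (P (2 * N) * inverse (P k * P (2 * N - k))) :: bit fps)"
      by (simp only: mult.assoc)
  qed
  finally show ?thesis
    unfolding sum_distrib_left[symmetric] by simp
qed

text \<open>In the finite triple product, the quotient of products attached to each power becomes 1
  after multiplication by \<open>P N\<close>, to the precision needed.\<close>

lemma bit_theta_congruence:
  assumes "N > 0"
  shows "fps_cong N
    (qpoch (fps_X ^ 6) (fps_X ^ 6) N * (qpoch fps_X (fps_X ^ 6) N * qpoch (fps_X ^ 5) (fps_X ^ 6) N))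
    (\<Sum>k\<le>2 * N. fps_X ^ theta_exponent N k :: bit fps)"
proof -
  define P where "P = (qpoch (fps_X ^ 6) (fps_X ^ 6) :: nat \<Rightarrow> bit fps)"
  have P0: "P m $ 0 = 1" for m
    by (simp add: P_def)
  have PN: "fps_cong N (P m) (P N)" if "m \<ge> N" for m
    unfolding P_def by (rule qpoch_beyond_N_cong) (use that in auto)
  have "fps_cong N (P N * (fps_X ^ theta_exponent N k * (P (2 * N) * inverse (P k * P (2 *
      N - k))))) (fps_X ^ theta_exponent N k)"
    if k: "k \<le> 2 * N" for k
  proof -
    define s where "s = nat \<bar>int k - int N\<bar>"
    define e where "e = theta_exponent N k"
    have s: "s \<le> N" "s \<le> e"
      using k theta_exponent_ge[of k N] by (auto simp: s_def e_def)
    \<comment> \<open>The two lengths lie symmetrically about \<open>N\<close>; only the shorter one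
      loses precision, and the exponent \<open>e\<close>, at least \<open>s\<close>, makes up for
      it.\<close>
    have "k = N - s \<and> 2 * N - k = N + s \<or> k = N + s \<and> 2 * N - k = N - s"
      using k by (auto simp: s_def)
    then have "P k * P (2 * N - k) = P (N - s) * P (N + s)"
      by (auto simp: mult.commute)
    then have "P N * (fps_X ^ e * (P (2 * N) * inverse (P k * P (2 * N - k)))) =
        fps_X ^ e * ((P N * P (2 * N)) * inverse (P (N - s) * P (N + s)))"
      by (simp only: ac_simps)
    also have "fps_cong N \<dots> (fps_X ^ e * ((P N * P (2 * N)) * inverse (P N * P (N + s))))"
      unfolding P_def by (rule qpoch_near_N_cong) (use s in auto)
    also have "fps_cong N \<dots> (fps_X ^ e * ((P N * P N) * inverse (P N * P N)))"
      by (intro fps_cong_mult fps_cong_refl PN fps_cong_inverse) (simp_all add: P0)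
    also have "(P N * P N) * inverse (P N * P N) = 1"
      by (rule inverse_mult_eq_1') (simp add: P0)
    finally show ?thesis
      by (simp add: e_def)
  qed
  then have "fps_cong N (\<Sum>k\<le>2 * N. P N * (fps_X ^ theta_exponent N k * (P (2 * N) *
      inverse (P k * P (2 * N - k)))))
      (\<Sum>k\<le>2 * N. fps_X ^ theta_exponent N k)"
    by (intro fps_cong_sum) simp
  then show ?thesis
    unfolding bit_finite_triple_product[OF assms] sum_distrib_left P_def .
qed

section \<open>Theta exponents and squares\<close>

lemma theta_exponent_square: "3 * int (theta_exponent N k) + 1 = (3 * (int k - int N) - 1)\<^sup>2"
  unfolding theta_exponent_eq by (simp add: power2_eq_square algebra_simps)

text \<open>Guarantees that no two theta terms cancel modulo 2. Equal squares
  \<open>(3r-1)^2\<close> and \<open>(3r'-1)^2\<close> with distinct \<open>r\<close> and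
  \<open>r'\<close> would force \<open>3(r + r') = 2\<close>.\<close>

lemma theta_exponent_inj:
  assumes "theta_exponent N k = theta_exponent N l"
  shows "k = l"
proof -
  have "(3 * (int k - int N) - 1)\<^sup>2 = (3 * (int l - int N) - 1)\<^sup>2"
    using assms by (metis theta_exponent_square)
  then have "3 * (int k - int N) - 1 = 3 * (int l - int N) - 1 \<or>
      3 * (int k - int N) - 1 = - (3 * (int l - int N) - 1)"
    by (simp add: power2_eq_iff)
  then have "int k = int l \<or> 3 * (int k + int l - 2 * int N) = 2"
    by (auto simp: algebra_simps)
  moreover have "3 * z \<noteq> 2" for z :: int
    by presburger
  ultimately show ?thesis
    by (metis of_nat_eq_iff)
qed

lemma theta_exponent_surj:
  assumes "3 * j + 1 = m ^ 2" "j < N"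
  shows "\<exists>k\<le>2 * N. theta_exponent N k = j"
proof -
  have "m mod 3 \<noteq> 0"
  proof
    assume "m mod 3 = 0"
    then have "3 dvd m ^ 2"
      by (simp add: power2_eq_square mod_0_imp_dvd)
    then show False
      using assms(1) by presburger
  qed
  \<comment> \<open>The residue of \<open>m\<close> modulo 3 decides which of the roots
    \<open>m\<close> and \<open>-m\<close> has the form \<open>3r - 1\<close>.\<close>
  then have "\<exists>r. int m = 3 * r - 1 \<or> int m = 1 - 3 * r"
    by presburger
  then obtain r where "int m = 3 * r - 1 \<or> int m = 1 - 3 * r"
    by blast
  then have sq: "(3 * r - 1)\<^sup>2 = 3 * int j + 1"
    using assms(1) by (metis of_nat_1 of_nat_add of_nat_mult of_nat_numeral of_nat_power power2_commute)
  define k where "k = nat (r + int N)"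
  have "\<bar>r\<bar> \<le> int j"
    using sq abs_le_theta_form[of r] by (simp add: power2_eq_square algebra_simps)
  then have k: "int k - int N = r" "k \<le> 2 * N"
    using assms(2) by (auto simp: k_def)
  have "3 * int (theta_exponent N k) + 1 = 3 * int j + 1"
    unfolding theta_exponent_square k(1) by (rule sq)
  then show ?thesis
    using k(2) by auto
qed

lemma bit_theta_nth:
  assumes "j < N"
  shows "(\<Sum>k\<le>2 * N. fps_X ^ theta_exponent N k :: bit fps) $ j = of_bool (\<exists>m. 3 * j + 1 = m ^ 2)"
proof (cases "\<exists>m. 3 * j + 1 = m ^ 2")
  case True
  then obtain k where k: "k \<le> 2 * N" "theta_exponent N k = j"
    using theta_exponent_surj assms by blast
  then have "(\<Sum>l\<le>2 * N. fps_X ^ theta_exponent N l :: bit fps) $ j = (\<Sum>l\<le>2 *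
      N. if l = k then 1 else 0)"
    unfolding fps_sum_nth by (intro sum.cong) (auto simp: fps_X_power_nth dest: theta_exponent_inj)
  then show ?thesis
    using k True by simp
next
  case False
  have "theta_exponent N k \<noteq> j" for k
  proof
    assume "theta_exponent N k = j"
    then have "int (3 * j + 1) = int (nat \<bar>3 * (int k - int N) - 1\<bar> ^ 2)"
      using theta_exponent_square[of N k] by simp
    then show False
      using False by (metis of_nat_eq_iff)
  qed
  then show ?thesis
    using False by (simp add: fps_sum_nth fps_X_power_nth eq_commute[of j])
qed

subsection \<open>The coefficients of \<open>\<xi>\<close>\<close>

text \<open>The Bailey sum has numerators \<open>q^(3 e r)\<close>, denominators in
  \<open>q^3\<close>, and factors \<open>G r\<close> fixed by extraction. Extraction turns
  \<open>3 e r\<close> into \<open>e r\<close> and \<open>P\<close> into \<open>R\<close>, which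
  yields the summands of the partial fraction expansion of \<open>1/D\<close>, but with
  \<open>R\<close> for \<open>P\<close>. So one series \<open>Y\<close> governs both sums.\<close>

lemma bit_trisect_bailey:
  fixes N :: nat
  defines "P \<equiv> qpoch (fps_X ^ 6) (fps_X ^ 6) :: nat \<Rightarrow> bit fps"
    and "R \<equiv> qpoch (fps_X ^ 2) (fps_X ^ 2) :: nat \<Rightarrow> bit fps"
    and "D \<equiv> (\<lambda>n. qpoch fps_X (fps_X ^ 6) n * qpoch (fps_X ^ 5) (fps_X ^ 6) n)"
  shows "fps_cong N
    (trisect (P N * (\<Sum>n\<le>N. fps_X ^ (6 * (n * Suc n)) * inverse (P (N - n) * D (Suc n)))))
    (P N * D N :: bit fps)"
proof -
  \<comment> \<open>Signs are absent in characteristic 2; the exponent stays a sum to match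
    \<open>trisect_geometric_pair\<close>.\<close>
  define G where "G = (\<lambda>r. (1 - fps_X ^ ((6 * r + 1) + (6 * r + 5))) *
    inverse ((1 - fps_X ^ (6 * r + 1)) * (1 - fps_X ^ (6 * r + 5))) :: bit fps)"
  define e where "e = (\<lambda>r. 6 * (Suc r choose 2))"
  define Y where "Y = (\<Sum>r\<le>N. fps_X ^ e r * G r)"
  have xy: "fps_X * fps_X ^ 5 = (fps_X ^ 6 :: bit fps)"
    by (simp add: eval_nat_numeral)
  have G: "(1 - (fps_X ^ 6) ^ (2 * r + 1)) * inverse ((1 - fps_X * (fps_X ^ 6) ^ r) * (1 - fps_X ^ 5 *
      (fps_X ^ 6) ^ r)) = G r" for r
  proof -
    have "(fps_X ^ 6) ^ (2 * r + 1) = (fps_X ^ ((6 * r + 1) + (6 * r + 5)) :: bit fps)"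
      unfolding power_mult[symmetric] by (rule arg_cong[where f = "power fps_X"]) simp
    moreover have "fps_X * (fps_X ^ 6) ^ r = (fps_X ^ (6 * r + 1) :: bit fps)"
      by (simp add: power_mult)
    moreover have "fps_X ^ 5 * (fps_X ^ 6) ^ r = (fps_X ^ (6 * r + 5) :: bit fps)"
      unfolding power_mult[symmetric] power_add[symmetric] by (simp only: add.commute)
    ultimately show ?thesis
      by (simp only: G_def)
  qed
  have trisect_G: "trisect (G r) = G r" for r
    unfolding G_def by (rule trisect_geometric_pair) presburger+
  have P0: "P m $ 0 = 1" and R0: "R m $ 0 = 1" and D0: "D m $ 0 = 1" for m
    by (simp_all add: P_def R_def D_def)
  have PR: "P m = R m oo fps_X ^ 3" for m
    unfolding P_def R_def using qpoch_compose_cube[of 2 2 m] by simp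
  have e: "r \<le> e r" for r
    by (simp add: e_def choose_2_Suc)

  have "(\<Sum>n\<le>N. fps_X ^ (6 * (n * Suc n)) * inverse (P (N - n) * D (Suc n))) =
      (\<Sum>r\<le>N. fps_X ^ (3 * e r) * (G r * inverse (P (N - r) * P (N + 1 + r))))"
  proof -
    have pw: "(fps_X ^ 6) ^ (3 * (Suc r choose 2)) = (fps_X ^ (3 * e r) :: bit fps)" for r
      unfolding e_def power_mult[symmetric] by (rule arg_cong[where f = "power fps_X"]) simp
    show ?thesis
      using fps_bailey_transform[of "fps_X ^ 6", OF _ xy, of N]
      unfolding pw P_def D_def power_mult[of _ 6 "_ * Suc _"] G[symmetric]
      by (simp add: mult.assoc)
  qed
  \<comment> \<open>All factors except \<open>G r\<close> are series in the cube of the variable and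
    pass through \<open>trisect\<close>.\<close>
  also have "trisect \<dots> = (\<Sum>r\<le>N. fps_X ^ e r * (G r * inverse (R (N - r) * R (N + 1 + r))))"
    unfolding trisect_sum
  proof (rule sum.cong[OF refl])
    fix r
    have "inverse (P (N - r) * P (N + 1 + r)) = inverse (R (N - r) * R (N + 1 + r)) oo fps_X ^ 3"
      using R0 by (simp add: PR fps_inverse_compose fps_compose_mult_distrib)
    then have "fps_X ^ (3 * e r) * (G r * inverse (P (N - r) * P (N + 1 + r))) =
        ((fps_X ^ e r * inverse (R (N - r) * R (N + 1 + r))) oo fps_X ^ 3) * G r"
      by (simp add: fps_compose_mult_distrib fps_X_power_compose_cube ac_simps)
    then show "trisect (fps_X ^ (3 * e r) * (G r * inverse (P (N - r) * P (N + 1 + r)))) =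
        fps_X ^ e r * (G r * inverse (R (N - r) * R (N + 1 + r)))"
      by (simp only: trisect_compose_mult trisect_G) (simp only: ac_simps)
  qed
  finally have lhs: "trisect (P N * (\<Sum>n\<le>N. fps_X ^ (6 * (n * Suc n)) * inverse (P (N - n) *
      D (Suc n)))) =
      R N * (\<Sum>r\<le>N. fps_X ^ e r * (G r * inverse (R (N - r) * R (N + 1 + r))))"
    by (simp add: PR trisect_compose_mult)

  \<comment> \<open>Stated for general \<open>Q\<close>, as it serves both \<open>P\<close> (partial
    fractions) and \<open>R\<close> (extracted Bailey sum).\<close>
  have near: "fps_cong N (\<Sum>r\<le>N. fps_X ^ e r * (G r * inverse (Q (N - r) * Q (N + 1 +
      r)))) (Y * inverse (Q N * Q N))"
    if Q: "Q = qpoch (fps_X ^ b) (fps_X ^ b)" and b: "b > 0" for Q :: "nat \<Rightarrow> bit fps" and b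
    unfolding Y_def sum_distrib_right
  proof (rule fps_cong_sum)
    fix r assume "r \<in> {..N}"
    then have "fps_cong N (fps_X ^ e r * (G r * inverse (Q (N - r) * Q (N + 1 + r)))) (fps_X ^ e r *
        (G r * inverse (Q N * Q (N + 1 + r))))"
      unfolding Q by (intro qpoch_near_N_cong) (use b e in auto)
    also have "fps_cong N \<dots> (fps_X ^ e r * (G r * inverse (Q N * Q N)))"
      unfolding Q by (intro fps_cong_mult fps_cong_refl fps_cong_inverse qpoch_beyond_N_cong) (use b in auto)
    finally show "fps_cong N (fps_X ^ e r * (G r * inverse (Q (N - r) * Q (N + 1 + r)))) (fps_X ^ e r *
        G r * inverse (Q N * Q N))"
      by (simp only: mult.assoc)
  qed

  \<comment> \<open>The partial fractions for \<open>x = q\<close>, \<open>y = q^5\<close> and base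
    \<open>q^6\<close> determine \<open>Y\<close> as \<open>P^2 / D\<close>.\<close>
  have "inverse (D (Suc N)) = (\<Sum>r\<le>N. fps_X ^ e r * (G r * inverse (P (N - r) * P (N + 1 + r))))"
  proof -
    have pw: "(fps_X ^ 6) ^ (Suc r choose 2) = (fps_X ^ e r :: bit fps)" for r
      unfolding e_def power_mult[symmetric] ..
    show ?thesis
      using fps_inverse_qpoch_partial_fractions[of "fps_X ^ 6", OF _ xy, of N]
      unfolding pw P_def D_def G[symmetric] by (simp add: mult.assoc)
  qed
  also have "fps_cong N \<dots> (Y * inverse (P N * P N))"
    by (rule near[of P 6]) (simp_all add: P_def)
  finally have "fps_cong N (inverse (D (Suc N))) (Y * inverse (P N * P N))" .
  moreover have "fps_cong N (inverse (D (Suc N))) (inverse (D N))"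
  proof (rule fps_cong_inverse)
    show "fps_cong N (D (Suc N)) (D N)"
      unfolding D_def using qpoch_fps_cong[of N "Suc N" N 1 6] qpoch_fps_cong[of N "Suc N" N 5 6]
      by (intro fps_cong_mult) simp_all
  qed (simp_all add: D0)
  ultimately have "fps_cong N (Y * inverse (P N * P N)) (inverse (D N))"
    by (blast intro: fps_cong_trans fps_cong_sym)
  then have "fps_cong N (Y * inverse (P N * P N) * (P N * P N)) (inverse (D N) * (P N * P N))"
    by (rule fps_cong_mult) simp
  moreover have "inverse (P N * P N) * (P N * P N) = 1"
    by (rule inverse_mult_eq_1) (simp add: P0)
  ultimately have Y: "fps_cong N Y (inverse (D N) * (P N * P N))"
    by (simp only: mult.assoc mult_1_right)

  have "fps_cong N (R N * (\<Sum>r\<le>N. fps_X ^ e r * (G r * inverse (R (N - r) * R (N + 1 + r)))))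
      (R N * (Y * inverse (R N * R N)))"
    by (intro fps_cong_mult fps_cong_refl near[of R 2]) (simp_all add: R_def)
  \<comment> \<open>Only one of the two factors \<open>P N\<close> is replaced by
    \<open>R D^2\<close>; the other survives in the result \<open>P D\<close>.\<close>
  also have "fps_cong N \<dots> (R N * ((inverse (D N) * (P N * (R N * (D N)\<^sup>2))) * inverse (R N * R N)))"
  proof (intro fps_cong_mult fps_cong_refl)
    have "fps_cong N (P N) (R N * (D N)\<^sup>2)"
      unfolding P_def R_def D_def by (rule bit_product_congruence)
    then have "fps_cong N (inverse (D N) * (P N * P N)) (inverse (D N) * (P N * (R N * (D N)\<^sup>2)))"
      by (intro fps_cong_mult fps_cong_refl)
    then show "fps_cong N Y (inverse (D N) * (P N * (R N * (D N)\<^sup>2)))"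
      by (rule fps_cong_trans[OF Y])
  qed
  also have "R N * ((inverse (D N) * (P N * (R N * (D N)\<^sup>2))) * inverse (R N * R N)) =
      (inverse (D N) * D N) * (inverse (R N * R N) * (R N * R N)) * (P N * D N)"
    unfolding power2_eq_square by (simp only: ac_simps)
  also have "\<dots> = P N * D N"
    using inverse_mult_eq_1[of "D N"] inverse_mult_eq_1[of "R N * R N"] by (simp add: D0 R0)
  finally show ?thesis
    unfolding lhs .
qed

section \<open>Reduction modulo 2 and conclusion\<close>

definition reduce_mod_2 :: "int fps \<Rightarrow> bit fps" where
  "reduce_mod_2 f = Abs_fps (\<lambda>n. of_int (f $ n))"

lemma reduce_mod_2_nth [simp]: "reduce_mod_2 f $ n = of_int (f $ n)"
  by (simp add: reduce_mod_2_def)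

lemma reduce_mod_2_hom:
  "reduce_mod_2 1 = 1" "reduce_mod_2 fps_X = fps_X"
  "reduce_mod_2 (f - g) = reduce_mod_2 f - reduce_mod_2 g"
  "reduce_mod_2 (f * g) = reduce_mod_2 f * reduce_mod_2 g"
  by (simp_all add: fps_eq_iff fps_mult_nth fps_X_def del: minus_bit_def)

lemma reduce_mod_2_power: "reduce_mod_2 (f ^ n) = reduce_mod_2 f ^ n"
  by (induction n) (simp_all add: reduce_mod_2_hom)

lemma reduce_mod_2_qpoch:
  "reduce_mod_2 (qpoch a q n) = qpoch (reduce_mod_2 a) (reduce_mod_2 q) n"
  by (induction n) (simp_all add: qpoch_Suc reduce_mod_2_hom reduce_mod_2_power)

text \<open>Reduction preserves the equation of \<open>xi_denom_inverse\<close>, and inverses are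
  unique, so the right inverse becomes \<open>inverse\<close>. Splitting off one factor
  \<open>fps_X\<close> turns exponents \<open>3k + 1\<close> into \<open>3k\<close>.\<close>

lemma reduce_mod_2_xi_term:
  "reduce_mod_2 (xi_term (Suc n)) = fps_X * (fps_X ^ (6 * (n * Suc n)) *
     inverse (qpoch fps_X (fps_X ^ 6) (Suc n) * qpoch (fps_X ^ 5) (fps_X ^ 6) (Suc n)))"
proof -
  let ?D = "qpoch fps_X (fps_X ^ 6) (Suc n) * qpoch (fps_X ^ 5) (fps_X ^ 6) (Suc n) :: bit fps"
  have "reduce_mod_2 (xi_denom (Suc n)) = ?D"
    by (simp add: xi_denom_def reduce_mod_2_hom reduce_mod_2_power reduce_mod_2_qpoch)
  then have "?D * reduce_mod_2 (fps_right_inverse (xi_denom (Suc n)) 1) = 1"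
    using arg_cong[OF xi_denom_inverse[of "Suc n"], of reduce_mod_2] by (simp only: reduce_mod_2_hom)
  then have "reduce_mod_2 (fps_right_inverse (xi_denom (Suc n)) 1) = inverse ?D"
    by (rule fps_inverse_unique[symmetric])
  moreover have "6 * (Suc n)\<^sup>2 - 6 * Suc n + 1 = Suc (6 * (n * Suc n))"
    by (simp add: power2_eq_square algebra_simps)
  ultimately show ?thesis
    by (simp add: xi_term_def reduce_mod_2_hom reduce_mod_2_power mult.assoc)
qed

text \<open>Convergence is coefficientwise, so a long enough partial sum has the right coefficient,
  and terms from index \<open>K\<close> on do not reach degree \<open>m\<close>. Positivity of
  \<open>m\<close> discards the constant 1 of \<open>xi\<close>.\<close>

lemma p_xi_eq:
  assumes "0 < m" "m \<le> K"
  shows "p_xi m = 2 * (\<Sum>n<K. xi_term (Suc n) $ m)"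
proof -
  have "(\<lambda>N. \<Sum>k<N. xi_term (Suc k)) \<longlonglongrightarrow> (\<Sum>n. xi_term (Suc n))"
    using summable_xi_term by (rule summable_LIMSEQ)
  then have "\<forall>\<^sub>F N in sequentially. (\<Sum>k<N. xi_term (Suc k)) $ m = (\<Sum>n. xi_term (Suc n)) $ m"
    by (simp add: tendsto_fps_iff)
  then obtain N0 where N0: "\<And>N. N \<ge> N0 \<Longrightarrow> (\<Sum>k<N. xi_term (Suc k)) $ m =
      (\<Sum>n. xi_term (Suc n)) $ m"
    unfolding eventually_sequentially by blast
  have "(\<Sum>n. xi_term (Suc n)) $ m = (\<Sum>k<max N0 K. xi_term (Suc k) $ m)"
    using N0[of "max N0 K"] by (simp add: fps_sum_nth)
  also have "\<dots> = (\<Sum>n<K. xi_term (Suc n) $ m)"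
    by (rule sum.mono_neutral_right) (use assms(2) in \<open>auto simp: xi_term_nth_eq_0\<close>)
  finally show ?thesis
    unfolding p_xi_def xi_def mult_2 fps_add_nth using assms(1) by simp
qed

text \<open>Inserting \<open>P N / P (N - n)\<close> into the \<open>n\<close>-th summand changes
  nothing below degree \<open>N\<close>, because \<open>q^(6n(n+1))\<close> compensates; this brings
  the sum into the form of \<open>bit_trisect_bailey\<close>.\<close>

lemma bit_xi_coeff:
  "(\<Sum>n\<le>3 * k + 1. reduce_mod_2 (xi_term (Suc n)) $ (3 * k + 1)) = of_bool (\<exists>m. 3 * k + 1 = m ^ 2)"
proof -
  define N where "N = 3 * k + 1"
  define P where "P = (qpoch (fps_X ^ 6) (fps_X ^ 6) :: nat \<Rightarrow> bit fps)"
  define D where "D = (\<lambda>n. qpoch fps_X (fps_X ^ 6) n * qpoch (fps_X ^ 5) (fps_X ^ 6) n :: bit fps)"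
  have P0: "P m $ 0 = 1" and D0: "D m $ 0 = 1" for m
    by (simp_all add: P_def D_def)
  have "fps_cong N (P N * (\<Sum>n\<le>N. fps_X ^ (6 * (n * Suc n)) * inverse (P (N - n) * D (Suc n))))
      (\<Sum>n\<le>N. fps_X ^ (6 * (n * Suc n)) * inverse (D (Suc n)))"
    unfolding sum_distrib_left
  proof (rule fps_cong_sum)
    fix n assume n: "n \<in> {..N}"
    \<comment> \<open>A factor \<open>P N\<close> is added above and below to fit
      \<open>qpoch_near_N_cong\<close>.\<close>
    have "P N * (fps_X ^ (6 * (n * Suc n)) * inverse (P (N - n) * D (Suc n))) =
        fps_X ^ (6 * (n * Suc n)) * ((P N * inverse (D (Suc n)) * P N) * inverse (P (N - n) * P N))"
      using inverse_mult_eq_1[of "P N"] P0 by (simp add: fps_inverse_mult ac_simps)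
    also have "fps_cong N \<dots> (fps_X ^ (6 * (n * Suc n)) * ((P N * inverse (D (Suc n)) * P N) *
        inverse (P N * P N)))"
      unfolding P_def by (rule qpoch_near_N_cong) (use n in auto)
    also have "(P N * inverse (D (Suc n)) * P N) * inverse (P N * P N) = inverse (P N * P N) * (P N *
        P N) * inverse (D (Suc n))"
      by (simp only: ac_simps)
    also have "inverse (P N * P N) * (P N * P N) = 1"
      by (rule inverse_mult_eq_1) (simp add: P0)
    finally show "fps_cong N (P N * (fps_X ^ (6 * (n * Suc n)) * inverse (P (N - n) * D (Suc n))))
        (fps_X ^ (6 * (n * Suc n)) * inverse (D (Suc n)))"
      by simp
  qed
  then have "(\<Sum>n\<le>N. fps_X ^ (6 * (n * Suc n)) * inverse (D (Suc n))) $ (3 * k) =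
      trisect (P N * (\<Sum>n\<le>N. fps_X ^ (6 * (n * Suc n)) * inverse (P (N - n) * D (Suc n)))) $ k"
    by (simp add: fps_cong_def N_def)
  also have "\<dots> = (P N * D N) $ k"
    using bit_trisect_bailey[of N] by (simp add: fps_cong_def N_def P_def D_def)
  also have "\<dots> = (\<Sum>l\<le>2 * N. fps_X ^ theta_exponent N l) $ k"
    using bit_theta_congruence[of N] by (simp add: fps_cong_def N_def P_def D_def)
  also have "\<dots> = of_bool (\<exists>m. 3 * k + 1 = m ^ 2)"
    by (rule bit_theta_nth) (simp add: N_def)
  finally show ?thesis
    by (simp add: reduce_mod_2_xi_term fps_sum_nth N_def D_def)
qed

text \<open>The coefficient is \<open>2 s\<close> with \<open>s\<close> an integer, so modulo 4 only
  the parity of \<open>s\<close> matters, and this is its image in \<open>bit\<close>.\<close>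

theorem theorem4p3:
  fixes n :: nat
  shows "[p_xi (3 * n + 1) = (if \<exists>m::nat. 3 * n + 1 = m ^ 2 then 2 else 0)] (mod 4)"
proof -
  define s where "s = (\<Sum>k\<le>3 * n + 1. xi_term (Suc k) $ (3 * n + 1))"
  have p: "p_xi (3 * n + 1) = 2 * s"
    unfolding s_def lessThan_Suc_atMost[symmetric] by (rule p_xi_eq) simp_all
  have "(of_int s :: bit) = of_bool (\<exists>m. 3 * n + 1 = m ^ 2)"
    using bit_xi_coeff[of n] by (simp add: s_def)
  moreover have "of_int s = (of_bool (odd s) :: bit)"
    by (cases "even s") (auto elim!: evenE oddE)
  ultimately have "odd s \<longleftrightarrow> (\<exists>m. 3 * n + 1 = m ^ 2)"
    by (simp add: of_bool_eq_iff)
  moreover have "2 * s mod 4 = 2" if "odd s"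
    using that by presburger
  moreover have "2 * s mod 4 = 0" if "even s"
    using that by presburger
  ultimately show ?thesis
    unfolding p cong_def by auto
qed

end
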